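(* Let $\Omega=\{(x,y)\in\mathbb{R}^2 : |x|<y+1,\ x^2>4y\}$ and let $p\ge 1$ be a real number. Then there exists a constant $C=C(\Omega,p)$ such that for every nonnegative integer $n$ and every polynomial $P\in\mathcal{P}_n(\mathbb{R}^2)$, $$\max\left\{\left\|\frac{\partial P}{\partial x}\right\|_{L^p(\Omega)},\left\|\frac{\partial P}{\partial y}\right\|_{L^p(\Omega)}\right\}\le C\,n^{4}\,\|P\|_{L^p(\Omega)}.$$
   Context: $\mathcal{P}_n(\mathbb{R}^2)$ denotes the set of real polynomials in two variables of total degree at most $n$. $\|f\|_{L^p(\Omega)}=\left(\int_\Omega |f(x,y)|^p\,dx\,dy\right)^{1/p}$ with respect to Lebesgue measure. *)

theory Defs
  imports "HOL-Analysis.Analysis"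
begin

definition poly2 :: "nat \<Rightarrow> (real \<times> real \<Rightarrow> real) set" where
  "poly2 n = {f. \<exists>a :: nat \<Rightarrow> nat \<Rightarrow> real.
      \<forall>x y. f (x, y) = (\<Sum>i\<le>n. \<Sum>j\<le>n - i. a i j * x ^ i * y ^ j)}"

definition partial_x :: "(real \<times> real \<Rightarrow> real) \<Rightarrow> real \<times> real \<Rightarrow> real" where
  "partial_x f = (\<lambda>(x, y). deriv (\<lambda>t. f (t, y)) x)"

definition partial_y :: "(real \<times> real \<Rightarrow> real) \<Rightarrow> real \<times> real \<Rightarrow> real" where
  "partial_y f = (\<lambda>(x, y). deriv (\<lambda>t. f (x, t)) y)"

text \<open>The norm takes values in the extended nonnegative reals: a function that is not in
  $L^p$ has norm infinity. There is no real power on \<^typ>\<open>ennreal\<close>, hence the case distinction.\<close>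

definition Lp_norm :: "real \<Rightarrow> (real \<times> real) set \<Rightarrow> (real \<times> real \<Rightarrow> real) \<Rightarrow> ennreal" where
  "Lp_norm p S f =
    (let I = (\<integral>\<^sup>+z\<in>S. ennreal (\<bar>f z\<bar> powr p) \<partial>lborel)
     in if I = \<infinity> then \<infinity> else ennreal (enn2real I powr (1 / p)))"

definition Omega :: "(real \<times> real) set" where
  "Omega = {(x, y). \<bar>x\<bar> < y + 1 \<and> x\<^sup>2 > 4 * y}"

text \<open>The two inequalities defining \<^const>\<open>Omega\<close> also hold on two unbounded regions, because the
  lines $y = |x| - 1$ only touch the parabola $x^2 = 4y$, at the points $(2,1)$ and $(-2,1)$. With
  $x = u + v$ and $y = uv$, where $u$ and $v$ are distinct reals, \<^const>\<open>Omega\<close> is the set where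
  $u, v$ are both in $(-1,1)$, both greater than $1$, or both less than $-1$. The first of these
  is the bounded domain with two cusps that the two inequalities usually denote; it is the part
  with $y < 1$.\<close>

definition Omega_bdd :: "(real \<times> real) set" where
  "Omega_bdd = {(x, y). (x, y) \<in> Omega \<and> y < 1}"

end

theory Submission
  imports Defs
begin

text \<open>With $x = 2m$, $y = m^2 - d^2$ the bounded domain becomes the triangle
  $d > 0$, $|m| + d < 1$ with density proportional to $d$. The contractions
  $z \mapsto (1 - h) z + h v$ towards its vertices are bounded in the weighted $L^p$ for
  $h \le 1/2$, and composing a polynomial of degree $N$ with them gives a polynomial in $h$ with
  values in $L^p$. Applying Markov's inequality in $h$, in the form of a functional with nodes in
  $[0, 1/2]$ and norm $O(N^2)$, bounds the $m$- and $d$-derivatives. The derivative in $d$ is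
  $-2d\,\partial_y P$; evaluating at $h = 0$ by extrapolation from $h \ge c / N^2$ along the
  contractions to $(0, 1)$ removes the factor $d$ at the cost of another $O(N^2)$.

  On the unbounded set every nonzero polynomial has infinite norm.\<close>

text \<open>The obstacle is that the bounded domain is not convex: a segment from near one cusp to
  the other crosses the parabola, so affine contractions towards a cusp leave the domain. In the
  coordinates (m, d) they stay inside. The price is that y becomes quadratic, so P restricted to a
  segment has degree N = 2n, and that the Jacobian degenerates on d = 0, the preimage of the
  parabola. Functionals are used instead of inequalities because an identity q'(0) = sum of c_k
  q(h_k) holds for every base point z at once; convexity of the p-th power then turns it into a norm
  bound with factor sum of |c_k|, so no separate L^p theory is needed. Both factors N^2 come from
  the Chebyshev polynomial T of degree N: T'(1) = N^2, and T is still only cosh 1 at the point cosh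
  (1/N), which exceeds 1 by at least 1/(4 N^2). The same extrapolation, with far dilations in place
  of contractions, forces infinite norms on the unbounded set.\<close>

section \<open>Chebyshev polynomials and interpolation functionals\<close>

text \<open>All properties pass through the recurrence U = 2xT - S, so the induction carries two
  consecutive polynomials. The \<open>cosh\<close> identity gives the values to the right of
  [-1, 1].\<close>

lemma chebyshev_poly_exists:
  "\<exists>T :: real poly. degree T \<le> n \<and> (\<forall>x. poly T (cos x) = cos (real n * x)) \<and>
     (\<forall>u. poly T (cosh u) = cosh (real n * u)) \<and> poly (pderiv T) 1 = real n ^ 2"
proof -
  have "\<exists>(S :: real poly) T :: real poly.
     (degree S \<le> n \<and> (\<forall>x. poly S (cos x) = cos (real n * x)) \<and>
     (\<forall>u. poly S (cosh u) = cosh (real n * u)) \<and> poly (pderiv S) 1 = real n ^ 2) \<and>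
     (degree T \<le> Suc n \<and> (\<forall>x. poly T (cos x) = cos (real (Suc n) * x)) \<and>
     (\<forall>u. poly T (cosh u) = cosh (real (Suc n) * u)) \<and> poly (pderiv T) 1 = real (Suc n) ^ 2)"
  proof (induction n)
    case 0
    show ?case
      by (rule exI[of _ 1], rule exI[of _ "[:0, 1:]"]) (simp add: pderiv_pCons)
  next
    case (Suc n)
    then obtain S T :: "real poly" where
      S: "degree S \<le> n" "\<And>x. poly S (cos x) = cos (real n * x)"
        "\<And>u. poly S (cosh u) = cosh (real n * u)" "poly (pderiv S) 1 = real n ^ 2" and
      T: "degree T \<le> Suc n" "\<And>x. poly T (cos x) = cos (real (Suc n) * x)"
        "\<And>u. poly T (cosh u) = cosh (real (Suc n) * u)" "poly (pderiv T) 1 = real (Suc n) ^ 2"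
      by blast
    define U where "U = [:0, 2:] * T - S"
    have "degree ([:0, 2:] * T) \<le> Suc (Suc n)"
      using degree_mult_le[of "[:0, 2:]" T] T(1) by simp
    then have 1: "degree U \<le> Suc (Suc n)"
      unfolding U_def using S(1) by (intro degree_diff_le) auto
    have 2: "poly U (cos x) = cos (real (Suc (Suc n)) * x)" for x
    proof -
      have "cos (real (Suc (Suc n)) * x) + cos (real n * x)
        = cos (real (Suc n) * x + x) + cos (real (Suc n) * x - x)"
        by (simp add: algebra_simps)
      also have "\<dots> = 2 * cos x * cos (real (Suc n) * x)"
        unfolding cos_add cos_diff by simp
      finally show ?thesis by (simp add: U_def S T)
    qed
    have 3: "poly U (cosh u) = cosh (real (Suc (Suc n)) * u)" for u
    proof -
      have "cosh (real (Suc (Suc n)) * u) + cosh (real n * u)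
        = cosh (real (Suc n) * u + u) + cosh (real (Suc n) * u - u)"
        by (simp add: algebra_simps)
      also have "\<dots> = 2 * cosh u * cosh (real (Suc n) * u)"
        unfolding cosh_add cosh_diff by simp
      finally show ?thesis by (simp add: U_def S T)
    qed
    have 4: "poly (pderiv U) 1 = real (Suc (Suc n)) ^ 2"
      using S(4) T(4) T(2)[of 0]
      by (simp add: U_def pderiv_diff pderiv_smult pderiv_pCons algebra_simps power2_eq_square)
    show ?case
      by (rule exI[of _ T], rule exI[of _ U]) (use T 1 2 3 4 in blast)
  qed
  then show ?thesis by blast
qed

lemma lagrange_interpolation:
  fixes x :: "nat \<Rightarrow> real" and q :: "real poly"
  assumes inj: "inj_on x {..N}" and deg: "degree q \<le> N"
  shows "q = (\<Sum>k\<le>N. smult (poly q (x k) / (\<Prod>j\<in>{..N}-{k}. x k - x j))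
                          (\<Prod>j\<in>{..N}-{k}. [:- x j, 1:]))" (is "q = ?L")
proof (rule poly_eqI_degree[where A = "x ` {..N}"])
  have card: "card (x ` {..N}) = Suc N" using inj by (simp add: card_image)
  show "card (x ` {..N}) > degree q" using card deg by simp
  have "degree (smult c (\<Prod>j\<in>{..N}-{k}. [:- x j, 1:])) \<le> N" if "k \<le> N" for c k
  proof -
    have "degree (smult c (\<Prod>j\<in>{..N}-{k}. [:- x j, 1:])) \<le> degree (\<Prod>j\<in>{..N}-{k}. [:- x j, 1:])"
      by (rule degree_smult_le)
    also have "\<dots> \<le> (\<Sum>j\<in>{..N}-{k}. degree [:- x j, 1:])" 
      using degree_prod_sum_le[of "{..N}-{k}" "\<lambda>j. [:- x j, 1:]"] by (simp add: o_def)
    also have "\<dots> = N" using that by simp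
    finally show ?thesis .
  qed
  then have "degree ?L \<le> N" by (intro degree_sum_le) (auto simp del: degree_smult_eq)
  then show "card (x ` {..N}) > degree ?L" using card by simp
  fix z assume "z \<in> x ` {..N}"
  then obtain i where i: "i \<le> N" "z = x i" by auto
  have ne: "(\<Prod>j\<in>{..N}-{i}. x i - x j) \<noteq> 0"
    using inj i by (auto simp: inj_on_def)
  have z: "(\<Prod>j\<in>{..N}-{k}. x i - x j) = 0" if "k \<noteq> i" for k
    using that i by (intro prod_zero) auto
  have "poly ?L z = (\<Sum>k\<le>N. if k = i then poly q (x i) else 0)"
    unfolding poly_sum poly_smult poly_prod i
    by (intro sum.cong refl) (use ne z in auto)
  also have "\<dots> = poly q z" using i by simp
  finally show "poly q z = poly ?L z" by simp
qed

text \<open>The extrema of the Chebyshev polynomial are optimal nodes: to the right of them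
  the Lagrange basis polynomials alternate in sign with the values of the Chebyshev
  polynomial, whose value there is therefore the norm of the interpolation functional.\<close>

lemma chebyshev_nodes:
  assumes N: "N \<ge> 1"
  obtains x :: "nat \<Rightarrow> real" and c e :: "nat \<Rightarrow> real" where
    "\<And>k. k \<le> N \<Longrightarrow> \<bar>x k\<bar> \<le> 1"
    "(\<Sum>k\<le>N. \<bar>c k\<bar>) \<le> real N ^ 2"
    "\<And>q. degree q \<le> N \<Longrightarrow> poly (pderiv q) 1 = (\<Sum>k\<le>N. c k * poly q (x k))"
    "(\<Sum>k\<le>N. \<bar>e k\<bar>) \<le> cosh 1"
    "\<And>q. degree q \<le> N \<Longrightarrow> poly q (cosh (1 / real N)) = (\<Sum>k\<le>N. e k * poly q (x k))"
proof -
  define x where "x k = cos (real k * (pi / real N))" for k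
  have anti: "x j < x k" if "k < j" "j \<le> N" for k j
    unfolding x_def
  proof (rule cos_monotone_0_pi)
    show "real k * (pi / real N) < real j * (pi / real N)"
      using that N by (simp add: divide_simps)
    show "real j * (pi / real N) \<le> pi" using that N by (simp add: divide_simps)
  qed (use N in simp)
  have inj: "inj_on x {..N}"
    by (rule inj_onI) (metis anti atMost_iff less_irrefl linorder_neqE_nat)
  have xle: "\<bar>x k\<bar> \<le> 1" for k unfolding x_def by simp
  obtain T :: "real poly" where T: "degree T \<le> N" "\<And>x. poly T (cos x) = cos (real N * x)"
     "\<And>u. poly T (cosh u) = cosh (real N * u)" "poly (pderiv T) 1 = real N ^ 2"
    using chebyshev_poly_exists[of N] by blast
  have Tx: "poly T (x k) = (-1) ^ k" for k
    unfolding x_def T(2) using N by (simp add: cos_npi)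
  define D where "D k = (\<Prod>j\<in>{..N}-{k}. x k - x j)" for k
  define B where "B k = (\<Prod>j\<in>{..N}-{k}. [:- x j, 1:])" for k
  \<comment> \<open>The nodes decrease in the index, so exactly the k factors with j < k are
    negative; the resulting sign is that of T at \<open>x k\<close>.\<close>
  have sgnD: "(-1) ^ k * D k > 0" if k: "k \<le> N" for k
  proof -
    have split: "{..N} - {k} = {..<k} \<union> {k<..N}" "{..<k} \<inter> {k<..N} = {}" using k by auto
    have "D k = (\<Prod>j<k. x k - x j) * (\<Prod>j\<in>{k<..N}. x k - x j)"
      unfolding D_def split(1) by (rule prod.union_disjoint) (use split(2) in auto)
    also have "(\<Prod>j<k. x k - x j) = (\<Prod>j<k. (-1) * (x j - x k))" by simp
    also have "\<dots> = (-1) ^ k * (\<Prod>j<k. x j - x k)"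
      unfolding prod.distrib by simp
    finally have "(-1) ^ k * D k = (\<Prod>j<k. x j - x k) * (\<Prod>j\<in>{k<..N}. x k - x j)"
      by (simp flip: mult.assoc power_add mult_2)
    moreover have "(\<Prod>j<k. x j - x k) > 0" using anti k by (intro prod_pos) auto
    moreover have "(\<Prod>j\<in>{k<..N}. x k - x j) > 0" using anti k by (intro prod_pos) auto
    ultimately show ?thesis by simp
  qed
  have rep: "q = (\<Sum>k\<le>N. smult (poly q (x k) / D k) (B k))" if "degree q \<le> N" for q
    unfolding D_def B_def by (rule lagrange_interpolation[OF inj that])
  have abs: "\<bar>b / D k\<bar> = (-1) ^ k * b / D k" if "k \<le> N" "b \<ge> 0" for b k
  proof -
    have "(-1) ^ k * b / D k \<ge> 0"
      using sgnD[OF that(1)] that(2)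
      by (cases "even k") (auto simp: divide_simps mult_le_0_iff)
    moreover have "\<bar>(-1) ^ k * b / D k\<bar> = \<bar>b / D k\<bar>" by (simp add: abs_mult)
    ultimately show ?thesis by linarith
  qed
  define c where "c k = poly (pderiv (B k)) 1 / D k" for k
  \<comment> \<open>At cosh (1/N) the value of T is cosh (N * (1/N)) = cosh 1, a bound independent
    of N.\<close>
  define e where "e k = poly (B k) (cosh (1 / real N)) / D k" for k
  have c: "poly (pderiv q) 1 = (\<Sum>k\<le>N. c k * poly q (x k))" if "degree q \<le> N" for q
    by (subst rep[OF that])
      (simp add: c_def higher_pderiv_sum[of 1, simplified] poly_sum pderiv_smult mult.commute)
  have e: "poly q (cosh (1 / real N)) = (\<Sum>k\<le>N. e k * poly q (x k))" if "degree q \<le> N" for q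
    by (subst rep[OF that]) (simp add: e_def poly_sum mult.commute)
  \<comment> \<open>No node exceeds 1, so each linear factor is nonnegative from 1 onwards. By the
    product rule the derivative at 1 is a sum of products of such factors.\<close>
  have B1: "poly (B k) y \<ge> 0" if "y \<ge> 1" for k y
    unfolding B_def poly_prod using xle that by (intro prod_nonneg) (auto simp: abs_le_iff intro: order_trans)
  have B2: "poly (pderiv (B k)) 1 \<ge> 0" for k
    unfolding B_def pderiv_prod poly_sum poly_mult poly_prod using xle
    by (intro sum_nonneg mult_nonneg_nonneg prod_nonneg) (auto simp: abs_le_iff pderiv_pCons)
  have "(\<Sum>k\<le>N. \<bar>c k\<bar>) = (\<Sum>k\<le>N. c k * poly T (x k))"
    unfolding c_def Tx using B2 by (intro sum.cong refl) (simp add: abs mult.commute del: abs_divide)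
  also have "\<dots> = real N ^ 2" using c[OF T(1)] T(4) by simp
  finally have sc: "(\<Sum>k\<le>N. \<bar>c k\<bar>) \<le> real N ^ 2" by simp
  have "(\<Sum>k\<le>N. \<bar>e k\<bar>) = (\<Sum>k\<le>N. e k * poly T (x k))"
    unfolding e_def Tx using B1 cosh_real_ge_1 by (intro sum.cong refl) (simp add: abs mult.commute del: abs_divide)
  also have "\<dots> = cosh 1" using e[OF T(1)] T(3)[of "1 / real N"] N by simp
  finally have se: "(\<Sum>k\<le>N. \<bar>e k\<bar>) \<le> cosh 1" by simp
  show thesis by (rule that[OF xle sc c se e])
qed

text \<open>Averaging a second-order bound for exp u with the first-order bound for exp (-u) yields
  the coefficient 1/4. With u = 1/N it measures how far the extrapolation point lies beyond the
  nodes.\<close>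

lemma cosh_ge_quadratic:
  fixes u :: real
  assumes "u \<ge> 0"
  shows "cosh u \<ge> 1 + u\<^sup>2 / 4"
proof -
  have "1 + u + u\<^sup>2 / 2 \<le> exp u" by (rule exp_lower_Taylor_quadratic[OF assms])
  moreover have "1 + (- u) \<le> exp (- u)" by (rule exp_ge_add_one_self)
  ultimately show ?thesis by (simp add: cosh_def)
qed

lemma cosh_1_le_2: "cosh (1 :: real) \<le> 2"
proof -
  have "exp (-1 :: real) \<le> 1" by simp
  then show ?thesis using exp_le by (simp add: cosh_def del: exp_le_one_iff)
qed

text \<open>The affine map h = (1 - x) / 4 carries [-1, 1] onto [0, 1/2] and 1 to 0; the chain rule
  contributes the factor -4.\<close>

lemma markov_functional:
  assumes N: "N \<ge> 1"
  obtains h c :: "nat \<Rightarrow> real" where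
    "\<And>k. k \<le> N \<Longrightarrow> 0 \<le> h k \<and> h k \<le> 1 / 2"
    "(\<Sum>k\<le>N. \<bar>c k\<bar>) \<le> 4 * real N ^ 2"
    "\<And>q. degree q \<le> N \<Longrightarrow> poly (pderiv q) 0 = (\<Sum>k\<le>N. c k * poly q (h k))"
proof -
  obtain x c e :: "nat \<Rightarrow> real" where x: "\<And>k. k \<le> N \<Longrightarrow> \<bar>x k\<bar> \<le> 1"
    and c: "(\<Sum>k\<le>N. \<bar>c k\<bar>) \<le> real N ^ 2"
    "\<And>q. degree q \<le> N \<Longrightarrow> poly (pderiv q) 1 = (\<Sum>k\<le>N. c k * poly q (x k))"
    using chebyshev_nodes[OF N] by metis
  show thesis
  proof (rule that[of "\<lambda>k. (1 - x k) / 4" "\<lambda>k. - 4 * c k"])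
    show "0 \<le> (1 - x k) / 4 \<and> (1 - x k) / 4 \<le> 1 / 2" if "k \<le> N" for k
      using x[OF that] by auto
    have "(\<Sum>k\<le>N. \<bar>- 4 * c k\<bar>) = 4 * (\<Sum>k\<le>N. \<bar>c k\<bar>)"
      by (simp add: abs_mult sum_distrib_left)
    then show "(\<Sum>k\<le>N. \<bar>- 4 * c k\<bar>) \<le> 4 * real N ^ 2" using c(1) by simp
    fix q :: "real poly" assume "degree q \<le> N"
    then have "degree (pcompose q [:1/4, -1/4:]) \<le> N" by (simp add: degree_pcompose)
    from c(2)[OF this]
    have "- (poly (pderiv q) 0 / 4) = (\<Sum>k\<le>N. c k * poly q ((1 - x k) / 4))"
      by (simp add: pderiv_pcompose poly_pcompose pderiv_pCons diff_divide_distrib)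
    then have "poly (pderiv q) 0 = - 4 * (\<Sum>k\<le>N. c k * poly q ((1 - x k) / 4))" by simp
    then show "poly (pderiv q) 0 = (\<Sum>k\<le>N. - 4 * c k * poly q ((1 - x k) / 4))"
      by (simp add: sum_distrib_left mult.assoc)
  qed
qed

text \<open>With a = cosh (1/N), the map h = (a - x) / 6 carries a to 0. For nodes x in [-1, 1], a -
  x lies between 1/(4 N^2) and 3, because a \<le> 2; division by 6 gives both bounds on
  \<open>h k\<close>.\<close>

lemma extrapolation_functional:
  assumes N: "N \<ge> 1"
  obtains h c :: "nat \<Rightarrow> real" where
    "\<And>k. k \<le> N \<Longrightarrow> 1 / (24 * real N ^ 2) \<le> h k \<and> h k \<le> 1 / 2"
    "(\<Sum>k\<le>N. \<bar>c k\<bar>) \<le> 2"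
    "\<And>q. degree q \<le> N \<Longrightarrow> poly q 0 = (\<Sum>k\<le>N. c k * poly q (h k))"
proof -
  obtain x e :: "nat \<Rightarrow> real" where x: "\<And>k. k \<le> N \<Longrightarrow> \<bar>x k\<bar> \<le> 1"
    and e: "(\<Sum>k\<le>N. \<bar>e k\<bar>) \<le> cosh 1"
    "\<And>q. degree q \<le> N \<Longrightarrow> poly q (cosh (1 / real N)) = (\<Sum>k\<le>N. e k * poly q (x k))"
    using chebyshev_nodes[OF N] by metis
  define a where "a = cosh (1 / real N)"
  have "a \<le> cosh 1" unfolding a_def using N by (subst cosh_real_nonneg_le_iff) auto
  then have a2: "a \<le> 2" using cosh_1_le_2 by simp
  have a1: "1 + 1 / (4 * real N ^ 2) \<le> a"
    unfolding a_def using cosh_ge_quadratic[of "1 / real N"] by (simp add: power_divide)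
  show thesis
  proof (rule that[of "\<lambda>k. (a - x k) / 6" e])
    show "1 / (24 * real N ^ 2) \<le> (a - x k) / 6 \<and> (a - x k) / 6 \<le> 1 / 2" if "k \<le> N" for k
    proof -
      have "a - x k \<ge> 1 / (4 * real N ^ 2)" "a - x k \<le> 3" using x[OF that] a1 a2 by linarith+
      then show ?thesis by simp
    qed
    show "(\<Sum>k\<le>N. \<bar>e k\<bar>) \<le> 2" using e(1) cosh_1_le_2 by simp
    fix q :: "real poly" assume "degree q \<le> N"
    then have "degree (pcompose q [:a/6, -1/6:]) \<le> N" by (simp add: degree_pcompose)
    from e(2)[OF this, folded a_def]
    show "poly q 0 = (\<Sum>k\<le>N. e k * poly q ((a - x k) / 6))"
      by (simp add: poly_pcompose diff_divide_distrib)
  qed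
qed

section \<open>Convexity and integrals of p-th powers\<close>

text \<open>The point 0 must be included since the values |g| fed into it may vanish. With one
  endpoint 0, convexity reduces to t powr p \<le> t on (0, 1).\<close>

lemma convex_on_powr_nonneg:
  assumes "p \<ge> 1"
  shows "convex_on {0..} (\<lambda>x::real. x powr p)"
proof (rule convex_on_linorderI)
  fix t x y :: real
  assume t: "0 < t" "t < 1" and xy: "x \<in> {0..}" "y \<in> {0..}" "x < y"
  show "((1 - t) *\<^sub>R x + t *\<^sub>R y) powr p \<le> (1 - t) * x powr p + t * y powr p"
  proof (cases "x = 0")
    case True
    have "t powr p \<le> t powr 1" using t assms by (intro powr_mono') auto
    then show ?thesis using True t xy by (simp add: powr_mult mult_right_mono)
  next
    case False
    then show ?thesis
      using convex_onD[OF powr_convex[OF assms], of t x y] t xy by auto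
  qed
qed simp

text \<open>Jensen's inequality with the weights |c k| / A, which sum to 1.\<close>

lemma powr_abs_sum_le:
  fixes c g :: "'a \<Rightarrow> real"
  assumes p: "p \<ge> 1" and fin: "finite S" and A: "(\<Sum>k\<in>S. \<bar>c k\<bar>) = A" "A > 0"
  shows "\<bar>\<Sum>k\<in>S. c k * g k\<bar> powr p \<le> A powr p * (\<Sum>k\<in>S. \<bar>c k\<bar> / A * \<bar>g k\<bar> powr p)"
proof -
  have ne: "S \<noteq> {}" using A by auto
  have "\<bar>\<Sum>k\<in>S. c k * g k\<bar> \<le> (\<Sum>k\<in>S. \<bar>c k\<bar> * \<bar>g k\<bar>)"
    by (rule order_trans[OF sum_abs]) (simp add: abs_mult)
  also have "\<dots> = A * (\<Sum>k\<in>S. \<bar>c k\<bar> / A * \<bar>g k\<bar>)"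
    using A(2) by (simp add: sum_distrib_left)
  finally have "\<bar>\<Sum>k\<in>S. c k * g k\<bar> powr p \<le> (A * (\<Sum>k\<in>S. \<bar>c k\<bar> / A * \<bar>g k\<bar>)) powr p"
    using p by (intro powr_mono2) auto
  also have "\<dots> = A powr p * (\<Sum>k\<in>S. \<bar>c k\<bar> / A * \<bar>g k\<bar>) powr p"
    by (rule powr_mult)
  also have "(\<Sum>k\<in>S. \<bar>c k\<bar> / A * \<bar>g k\<bar>) powr p \<le> (\<Sum>k\<in>S. \<bar>c k\<bar> / A * \<bar>g k\<bar> powr p)"
    using convex_on_sum[OF fin ne convex_on_powr_nonneg[OF p], of "\<lambda>k. \<bar>c k\<bar> / A" "\<lambda>k. \<bar>g k\<bar>"] A
    by (simp flip: sum_divide_distrib)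
  finally show ?thesis by (simp add: mult_left_mono)
qed

text \<open>This plays the role of Minkowski's inequality: a combination of functions with p-th
  power integrals at most \<open>B\<close> costs only the factor A powr p. It stays in
  \<open>ennreal\<close>, so integrability never has to be checked. The case of vanishing
  coefficients is split off because the Jensen weights divide by their sum.\<close>

lemma nn_integral_powr_sum_le:
  fixes c :: "'a \<Rightarrow> real" and g :: "'a \<Rightarrow> 'b \<Rightarrow> real"
  assumes p: "p \<ge> 1" and fin: "finite S"
    and f: "\<And>z. z \<in> space M \<Longrightarrow> f z = (\<Sum>k\<in>S. c k * g k z)"
    and [measurable]: "\<And>k. k \<in> S \<Longrightarrow> g k \<in> borel_measurable M"
    and B: "\<And>k. k \<in> S \<Longrightarrow> (\<integral>\<^sup>+z. ennreal (\<bar>g k z\<bar> powr p) \<partial>M) \<le> B"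
    and A: "(\<Sum>k\<in>S. \<bar>c k\<bar>) \<le> A"
  shows "(\<integral>\<^sup>+z. ennreal (\<bar>f z\<bar> powr p) \<partial>M) \<le> ennreal (A powr p) * B"
proof (cases "(\<Sum>k\<in>S. \<bar>c k\<bar>) = 0")
  case True
  then have "f z = 0" if "z \<in> space M" for z
    using f[OF that] fin by (simp add: sum_nonneg_eq_0_iff)
  then have "(\<integral>\<^sup>+z. ennreal (\<bar>f z\<bar> powr p) \<partial>M) = (\<integral>\<^sup>+z. 0 \<partial>M)"
    by (intro nn_integral_cong) simp
  then show ?thesis by simp
next
  case False
  define a where "a = (\<Sum>k\<in>S. \<bar>c k\<bar>)"
  have a: "a > 0" "a \<le> A" using False A by (auto simp: a_def sum_nonneg order_less_le)
  have "(\<integral>\<^sup>+z. ennreal (\<bar>f z\<bar> powr p) \<partial>M)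
    \<le> (\<integral>\<^sup>+z. ennreal (a powr p) * (\<Sum>k\<in>S. ennreal (\<bar>c k\<bar> / a) * ennreal (\<bar>g k z\<bar> powr p)) \<partial>M)"
  proof (rule nn_integral_mono)
    fix z assume "z \<in> space M"
    then have "\<bar>f z\<bar> powr p \<le> a powr p * (\<Sum>k\<in>S. \<bar>c k\<bar> / a * \<bar>g k z\<bar> powr p)"
      using powr_abs_sum_le[OF p fin a_def[symmetric] a(1), of "\<lambda>k. g k z"] f by simp
    then have "ennreal (\<bar>f z\<bar> powr p)
      \<le> ennreal (a powr p) * ennreal (\<Sum>k\<in>S. \<bar>c k\<bar> / a * \<bar>g k z\<bar> powr p)"
      by (simp add: ennreal_leI flip: ennreal_mult')
    also have "ennreal (\<Sum>k\<in>S. \<bar>c k\<bar> / a * \<bar>g k z\<bar> powr p)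
      = (\<Sum>k\<in>S. ennreal (\<bar>c k\<bar> / a * \<bar>g k z\<bar> powr p))"
      using a by (intro sum_ennreal[symmetric]) auto
    also have "\<dots> = (\<Sum>k\<in>S. ennreal (\<bar>c k\<bar> / a) * ennreal (\<bar>g k z\<bar> powr p))"
      using a by (intro sum.cong refl ennreal_mult) auto
    finally show "ennreal (\<bar>f z\<bar> powr p)
      \<le> ennreal (a powr p) * (\<Sum>k\<in>S. ennreal (\<bar>c k\<bar> / a) * ennreal (\<bar>g k z\<bar> powr p))" .
  qed
  also have "\<dots> = ennreal (a powr p) *
      (\<Sum>k\<in>S. ennreal (\<bar>c k\<bar> / a) * (\<integral>\<^sup>+z. ennreal (\<bar>g k z\<bar> powr p) \<partial>M))"
    by (simp add: nn_integral_cmult nn_integral_sum)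
  also have "\<dots> \<le> ennreal (a powr p) * (\<Sum>k\<in>S. ennreal (\<bar>c k\<bar> / a) * B)"
    by (intro mult_left_mono sum_mono B) auto
  also have "(\<Sum>k\<in>S. ennreal (\<bar>c k\<bar> / a) * B) = B"
  proof -
    have "(\<Sum>k\<in>S. ennreal (\<bar>c k\<bar> / a)) = ennreal (\<Sum>k\<in>S. \<bar>c k\<bar> / a)"
      using a by (intro sum_ennreal) auto
    also have "(\<Sum>k\<in>S. \<bar>c k\<bar> / a) = 1"
      using a by (simp add: a_def flip: sum_divide_distrib)
    finally show ?thesis by (simp flip: sum_distrib_right)
  qed
  also have "ennreal (a powr p) * B \<le> ennreal (A powr p) * B"
    using a p by (intro mult_right_mono ennreal_leI powr_mono2) auto
  finally show ?thesis .
qed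

section \<open>The weighted triangle and its contractions\<close>

lemma nn_integral_lborel_affine:
  fixes t :: "'a :: euclidean_space"
  assumes [measurable]: "g \<in> borel_measurable borel" and c: "c \<noteq> 0"
  shows "(\<integral>\<^sup>+x. g x \<partial>lborel) = ennreal (\<bar>c\<bar> ^ DIM('a)) * (\<integral>\<^sup>+x. g (t + c *\<^sub>R x) \<partial>lborel)"
  by (subst lborel_affine[OF c, of t])
    (simp add: nn_integral_density nn_integral_distr nn_integral_cmult)

text \<open>With u = m + d and v = m - d one has x = u + v and y = uv, and d > 0 selects the order u
  > v. The side d = 0 is the parabola, the other two sides are the lines |x| = y + 1, the vertices
  (1, 0) and (-1, 0) are the cusps, and (0, 1) is the corner (0, -1).\<close>

definition tri :: "(real \<times> real) set" where
  "tri = {(m, d). 0 < d \<and> \<bar>m\<bar> + d < 1}"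

definition tri_weight :: "real \<times> real \<Rightarrow> ennreal" where
  "tri_weight z = ennreal (snd z) * indicator tri z"

definition tri_measure :: "(real \<times> real) measure" where
  "tri_measure = density lborel tri_weight"

lemma tri_borel [measurable]: "tri \<in> sets borel"
proof -
  have "open tri"
    unfolding tri_def case_prod_beta
    by (intro open_Collect_conj open_Collect_less continuous_intros)
  then show ?thesis by simp
qed

lemma tri_weight_borel [measurable]: "tri_weight \<in> borel_measurable borel"
proof -
  have [measurable]: "(snd :: real \<times> real \<Rightarrow> real) \<in> borel_measurable borel"
    by (intro borel_measurable_continuous_onI continuous_intros)
  show ?thesis unfolding tri_weight_def[abs_def] by measurable
qed

lemma tri_measure_simps [simp, measurable_cong]:
  "sets tri_measure = sets borel" "space tri_measure = UNIV"
  by (simp_all add: tri_measure_def)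

lemma nn_integral_tri_measure:
  assumes "g \<in> borel_measurable borel"
  shows "(\<integral>\<^sup>+z. g z \<partial>tri_measure) = (\<integral>\<^sup>+z. tri_weight z * g z \<partial>lborel)"
  unfolding tri_measure_def using assms by (intro nn_integral_density) auto

lemma nn_integral_tri_measure_mono:
  assumes [measurable]: "f \<in> borel_measurable borel" "g \<in> borel_measurable borel"
    and le: "\<And>z. z \<in> tri \<Longrightarrow> f z \<le> g z"
  shows "(\<integral>\<^sup>+z. f z \<partial>tri_measure) \<le> (\<integral>\<^sup>+z. g z \<partial>tri_measure)"
  unfolding nn_integral_tri_measure[OF assms(1)] nn_integral_tri_measure[OF assms(2)]
  by (intro nn_integral_mono) (auto simp: tri_weight_def split: split_indicator intro!: mult_left_mono le)

text \<open>The constant is 8 = 2 * 4: the weight at z is at most twice the weight at its image, and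
  the Jacobian (1 - h)^2 is at least 1/4. The target (a, b) may be any point of the closed
  triangle.\<close>

lemma nn_integral_tri_contraction:
  assumes g [measurable]: "g \<in> borel_measurable borel" and h: "0 \<le> h" "h \<le> 1 / 2"
    and ab: "0 \<le> b" "\<bar>a\<bar> + b \<le> 1"
  shows "(\<integral>\<^sup>+z. g (h *\<^sub>R (a, b) + (1 - h) *\<^sub>R z) \<partial>tri_measure) \<le> 8 * (\<integral>\<^sup>+z. g z \<partial>tri_measure)"
proof -
  define A :: "real \<times> real \<Rightarrow> real \<times> real" where "A z = h *\<^sub>R (a, b) + (1 - h) *\<^sub>R z" for z
  have [measurable]: "A \<in> borel_measurable borel"
    unfolding A_def by measurable
  \<comment> \<open>The image stays in the triangle by convexity, and its height is at least (1 - h)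
    d, hence at least d / 2. Outside the triangle the left side is 0.\<close>
  have w: "tri_weight z \<le> ennreal 2 * tri_weight (A z)" for z
  proof (cases "z \<in> tri")
    case True
    then obtain m d where z: "z = (m, d)" "0 < d" "\<bar>m\<bar> + d < 1" by (auto simp: tri_def)
    have snd: "snd (A z) = h * b + (1 - h) * d" by (simp add: A_def z)
    have "h * d \<le> 1 / 2 * d" by (rule mult_right_mono) (use h z in auto)
    then have d2: "d \<le> 2 * snd (A z)"
      using mult_nonneg_nonneg[OF h(1) ab(1)] unfolding snd by (simp add: algebra_simps)
    have "\<bar>h * a + (1 - h) * m\<bar> + snd (A z) \<le> \<bar>h * a\<bar> + \<bar>(1 - h) * m\<bar> + (h * b + (1 - h) * d)"
      unfolding snd by (intro add_right_mono abs_triangle_ineq)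
    also have "\<dots> = h * (\<bar>a\<bar> + b) + (1 - h) * (\<bar>m\<bar> + d)"
      using h by (simp add: abs_mult) (simp add: algebra_simps)
    also have "\<dots> < h * 1 + (1 - h) * 1"
      using h z ab by (intro add_le_less_mono mult_left_mono mult_strict_left_mono) auto
    finally have "A z \<in> tri"
      using d2 z by (simp add: tri_def A_def)
    then show ?thesis using True ennreal_leI[OF d2] z
      by (simp add: tri_weight_def ennreal_mult')
  qed (simp add: tri_weight_def)
  have "(\<integral>\<^sup>+z. g (A z) \<partial>tri_measure) = (\<integral>\<^sup>+z. tri_weight z * g (A z) \<partial>lborel)"
    by (rule nn_integral_tri_measure) measurable
  also have "\<dots> \<le> (\<integral>\<^sup>+z. ennreal 2 * (tri_weight (A z) * g (A z)) \<partial>lborel)"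
    using w by (intro nn_integral_mono) (metis mult.assoc mult_right_mono zero_le)
  also have "\<dots> = ennreal 2 * (\<integral>\<^sup>+z. tri_weight (A z) * g (A z) \<partial>lborel)"
    by (rule nn_integral_cmult) measurable
  also have "\<dots> \<le> ennreal 2 * (ennreal (4 * \<bar>1 - h\<bar> ^ 2) * (\<integral>\<^sup>+z. tri_weight (A z) * g (A z) \<partial>lborel))"
  proof (rule mult_left_mono)
    have "(1 / 2)\<^sup>2 \<le> \<bar>1 - h\<bar>\<^sup>2" using h by (intro power_mono) auto
    then have "ennreal 1 \<le> ennreal (4 * \<bar>1 - h\<bar> ^ 2)"
      by (intro ennreal_leI) (simp add: power2_eq_square)
    then show "(\<integral>\<^sup>+z. tri_weight (A z) * g (A z) \<partial>lborel)
      \<le> ennreal (4 * \<bar>1 - h\<bar> ^ 2) * (\<integral>\<^sup>+z. tri_weight (A z) * g (A z) \<partial>lborel)"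
      using mult_right_mono[of 1 "ennreal (4 * \<bar>1 - h\<bar> ^ 2)"] by simp
  qed simp
  also have "\<dots> = 8 * (ennreal (\<bar>1 - h\<bar> ^ DIM(real \<times> real)) * (\<integral>\<^sup>+z. tri_weight (A z) * g (A z) \<partial>lborel))"
    by (simp add: ennreal_mult mult.assoc flip: ennreal_numeral) (simp add: power2_eq_square flip: mult.assoc ennreal_mult)
  also have "\<dots> = 8 * (\<integral>\<^sup>+z. tri_weight z * g z \<partial>lborel)"
    unfolding A_def using h
    by (subst nn_integral_lborel_affine[of "\<lambda>z. tri_weight z * g z" "1 - h" "h *\<^sub>R (a, b)"]) auto
  also have "(\<integral>\<^sup>+z. tri_weight z * g z \<partial>lborel) = (\<integral>\<^sup>+z. g z \<partial>tri_measure)"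
    by (rule nn_integral_tri_measure[symmetric]) measurable
  finally show ?thesis unfolding A_def .
qed

section \<open>Change of variables to the bounded domain\<close>

definition param :: "real \<times> real \<Rightarrow> real \<times> real" where
  "param = (\<lambda>(m, d). (2 * m, m\<^sup>2 - d\<^sup>2))"

lemma param_borel [measurable]: "param \<in> borel_measurable borel"
  unfolding param_def case_prod_beta
  by (intro borel_measurable_continuous_onI continuous_intros)

lemma Omega_borel [measurable]: "Omega \<in> sets borel"
proof -
  have "open Omega"
    unfolding Omega_def case_prod_beta
    by (intro open_Collect_conj open_Collect_less continuous_intros)
  then show ?thesis by simp
qed

lemma Omega_bdd_borel [measurable]: "Omega_bdd \<in> sets borel"
proof -
  have "open (Omega \<inter> {z. snd z < 1})"
    unfolding Omega_def case_prod_beta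
    by (intro open_Int open_Collect_conj open_Collect_less continuous_intros)
  moreover have "Omega_bdd = Omega \<inter> {z. snd z < 1}"
    by (auto simp: Omega_bdd_def)
  ultimately show ?thesis by simp
qed

text \<open>Here e = m^2 - y is the depth below the parabola and will become d^2. The condition y <
  1 enters through 2|m| < y + 1 < 2, which excludes the unbounded components.\<close>

lemma Omega_bdd_slice:
  "(2 * m, m\<^sup>2 - e) \<in> Omega_bdd \<longleftrightarrow> \<bar>m\<bar> < 1 \<and> 0 < e \<and> e < (1 - \<bar>m\<bar>)\<^sup>2"
proof -
  have sq: "(1 - \<bar>m\<bar>)\<^sup>2 = 1 - 2 * \<bar>m\<bar> + m\<^sup>2"
    by (simp add: power2_eq_square algebra_simps)
  have "(2 * m, m\<^sup>2 - e) \<in> Omega_bdd \<longleftrightarrow> 2 * \<bar>m\<bar> < m\<^sup>2 - e + 1 \<and> 0 < e \<and> m\<^sup>2 - e < 1"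
    by (auto simp: Omega_bdd_def Omega_def power2_eq_square abs_mult)
  also have "\<dots> \<longleftrightarrow> \<bar>m\<bar> < 1 \<and> 0 < e \<and> e < (1 - \<bar>m\<bar>)\<^sup>2"
  proof (cases "\<bar>m\<bar> < 1")
    case True
    then have "m\<^sup>2 < 1" by (simp add: abs_square_less_1)
    then show ?thesis using True unfolding sq by auto
  next
    case False
    then show ?thesis by auto
  qed
  finally show ?thesis .
qed

lemma nn_integral_Omega_bdd_slice:
  assumes [measurable]: "F \<in> borel_measurable borel"
  shows "(\<integral>\<^sup>+y. F y * indicator Omega_bdd (2 * m, y) \<partial>lborel)
    = 2 * (\<integral>\<^sup>+d. tri_weight (m, d) * F (m\<^sup>2 - d\<^sup>2) \<partial>lborel)"
proof (cases "\<bar>m\<bar> < 1")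
  case False
  have "indicator Omega_bdd (2 * m, y) = (0 :: ennreal)" for y
    using Omega_bdd_slice[of m "m\<^sup>2 - y"] False by (simp add: indicator_def)
  moreover have "tri_weight (m, d) = 0" for d
    using False by (auto simp: tri_weight_def tri_def indicator_def)
  ultimately show ?thesis by simp
next
  case True
  define b where "b = 1 - \<bar>m\<bar>"
  have b: "b > 0" using True by (simp add: b_def)
  have [measurable]: "(\<lambda>y. indicator Omega_bdd (2 * m, y) :: ennreal) \<in> borel_measurable borel"
    by measurable
  have "(\<integral>\<^sup>+y. F y * indicator Omega_bdd (2 * m, y) \<partial>lborel)
    = (\<integral>\<^sup>+e. F (m\<^sup>2 - e) * indicator Omega_bdd (2 * m, m\<^sup>2 - e) \<partial>lborel)"
    using nn_integral_real_affine[of "\<lambda>y. F y * indicator Omega_bdd (2 * m, y)" "-1" "m\<^sup>2"] by simp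
  \<comment> \<open>The substitution e = d^2 is stated for closed intervals; the added endpoints are
    null sets. Its derivative 2d is the source of the weight.\<close>
  also have "\<dots> = (\<integral>\<^sup>+e. F (m\<^sup>2 - e) * indicator {0\<^sup>2..b\<^sup>2} e \<partial>lborel)"
  proof (rule nn_integral_cong_AE)
    show "AE e in lborel. F (m\<^sup>2 - e) * indicator Omega_bdd (2 * m, m\<^sup>2 - e)
        = F (m\<^sup>2 - e) * indicator {0\<^sup>2..b\<^sup>2} e"
      using AE_lborel_singleton[of 0] AE_lborel_singleton[of "b\<^sup>2"]
      by eventually_elim (use True in \<open>auto simp: indicator_def Omega_bdd_slice b_def\<close>)
  qed
  also have "\<dots> = (\<integral>\<^sup>+d. F (m\<^sup>2 - d\<^sup>2) * ennreal (2 * d) * indicator {0..b} d \<partial>lborel)"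
    by (rule nn_integral_substitution_aux)
      (use b in \<open>auto intro!: derivative_eq_intros continuous_intros\<close>)
  also have "\<dots> = (\<integral>\<^sup>+d. 2 * (tri_weight (m, d) * F (m\<^sup>2 - d\<^sup>2)) \<partial>lborel)"
  proof (rule nn_integral_cong_AE)
    show "AE d in lborel. F (m\<^sup>2 - d\<^sup>2) * ennreal (2 * d) * indicator {0..b} d
        = 2 * (tri_weight (m, d) * F (m\<^sup>2 - d\<^sup>2))"
      using AE_lborel_singleton[of 0] AE_lborel_singleton[of b]
      by eventually_elim
        (auto simp: indicator_def tri_weight_def tri_def b_def ennreal_mult' mult_ac)
  qed
  also have "\<dots> = 2 * (\<integral>\<^sup>+d. tri_weight (m, d) * F (m\<^sup>2 - d\<^sup>2) \<partial>lborel)"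
  proof (rule nn_integral_cmult)
    have [measurable]: "(\<lambda>d. tri_weight (m, d)) \<in> borel_measurable borel" by measurable
    show "(\<lambda>d. tri_weight (m, d) * F (m\<^sup>2 - d\<^sup>2)) \<in> borel_measurable lborel" by measurable
  qed
  finally show ?thesis .
qed

text \<open>The Jacobian of \<open>param\<close> is 4d in absolute value: one factor 2 from x = 2m
  and 2d from y = m^2 - d^2. The d is already contained in \<open>tri_measure\<close>.\<close>

lemma nn_integral_Omega_bdd:
  assumes g [measurable]: "g \<in> borel_measurable borel"
  shows "(\<integral>\<^sup>+z\<in>Omega_bdd. g z \<partial>lborel) = 4 * (\<integral>\<^sup>+z. g (param z) \<partial>tri_measure)"
proof -
  let ?w = tri_weight
  have g1: "(\<lambda>z. g z * indicator Omega_bdd z) \<in> borel_measurable (lborel \<Otimes>\<^sub>M lborel)"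
    unfolding lborel_prod by measurable
  have g2: "(\<lambda>z. ?w z * g (param z)) \<in> borel_measurable (lborel \<Otimes>\<^sub>M lborel)"
    unfolding lborel_prod by measurable
  have [measurable]: "(\<lambda>y. g (x, y)) \<in> borel_measurable borel" for x by measurable
  have "(\<integral>\<^sup>+z\<in>Omega_bdd. g z \<partial>lborel)
    = (\<integral>\<^sup>+x. \<integral>\<^sup>+y. g (x, y) * indicator Omega_bdd (x, y) \<partial>lborel \<partial>lborel)"
    using lborel.nn_integral_fst[OF g1] by (simp add: lborel_prod)
  also have "\<dots> = 2 * (\<integral>\<^sup>+m. \<integral>\<^sup>+y. g (2 * m, y) * indicator Omega_bdd (2 * m, y) \<partial>lborel \<partial>lborel)"
    using nn_integral_real_affine[of
      "\<lambda>x. \<integral>\<^sup>+y. g (x, y) * indicator Omega_bdd (x, y) \<partial>lborel" 2 0]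
      lborel.borel_measurable_nn_integral_fst[OF g1] by simp
  also have "\<dots> = 2 * (\<integral>\<^sup>+m. 2 * (\<integral>\<^sup>+d. ?w (m, d) * g (param (m, d)) \<partial>lborel) \<partial>lborel)"
    by (subst nn_integral_Omega_bdd_slice) (auto simp: param_def)
  also have "\<dots> = 4 * (\<integral>\<^sup>+m. \<integral>\<^sup>+d. ?w (m, d) * g (param (m, d)) \<partial>lborel \<partial>lborel)"
    using lborel.borel_measurable_nn_integral_fst[OF g2]
    by (subst nn_integral_cmult) (simp_all add: mult.assoc[symmetric])
  also have "(\<integral>\<^sup>+m. \<integral>\<^sup>+d. ?w (m, d) * g (param (m, d)) \<partial>lborel \<partial>lborel)
    = (\<integral>\<^sup>+z. ?w z * g (param z) \<partial>lborel)"
    using lborel.nn_integral_fst[OF g2] by (simp add: lborel_prod)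
  also have "\<dots> = (\<integral>\<^sup>+z. g (param z) \<partial>tri_measure)"
    by (rule nn_integral_tri_measure[symmetric]) measurable
  finally show ?thesis .
qed

section \<open>Polynomials along curves\<close>

text \<open>A degree bound on functions rather than an exact degree, so that sums and products can
  be handled without attention to cancellation.\<close>

definition polyfun_le :: "nat \<Rightarrow> (real \<Rightarrow> real) \<Rightarrow> bool" where
  "polyfun_le N f \<longleftrightarrow> (\<exists>q. degree q \<le> N \<and> (\<forall>h. f h = poly q h))"

lemma polyfun_le_mono: "polyfun_le M f \<Longrightarrow> M \<le> N \<Longrightarrow> polyfun_le N f"
  unfolding polyfun_le_def using le_trans by blast

lemma polyfun_le_const: "polyfun_le 0 (\<lambda>h. c)"
  unfolding polyfun_le_def by (rule exI[of _ "[:c:]"]) simp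

lemma polyfun_le_mult:
  assumes "polyfun_le M f" "polyfun_le N g"
  shows "polyfun_le (M + N) (\<lambda>h. f h * g h)"
proof -
  obtain q r where "degree q \<le> M" "\<forall>h. f h = poly q h" "degree r \<le> N" "\<forall>h. g h = poly r h"
    using assms unfolding polyfun_le_def by blast
  moreover from this have "degree (q * r) \<le> M + N"
    using degree_mult_le[of q r] by linarith
  ultimately show ?thesis
    unfolding polyfun_le_def by (intro exI[of _ "q * r"]) simp
qed

lemma polyfun_le_power: "polyfun_le M f \<Longrightarrow> polyfun_le (i * M) (\<lambda>h. f h ^ i)"
  by (induction i) (use polyfun_le_const[of 1] polyfun_le_mult in auto)

lemma polyfun_le_sum:
  assumes "\<And>i. i \<in> A \<Longrightarrow> polyfun_le N (f i)"
  shows "polyfun_le N (\<lambda>h. \<Sum>i\<in>A. f i h)"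
proof -
  obtain q where "\<And>i. i \<in> A \<Longrightarrow> degree (q i) \<le> N \<and> (\<forall>h. f i h = poly (q i) h)"
    using assms unfolding polyfun_le_def by metis
  then show ?thesis
    unfolding polyfun_le_def
    by (intro exI[of _ "\<Sum>i\<in>A. q i"])
      (cases "finite A"; auto intro!: degree_sum_le simp: poly_sum)
qed

lemma polyfun_le_affine: "polyfun_le 1 (\<lambda>h. a + h * b)"
  unfolding polyfun_le_def by (rule exI[of _ "[:a, b:]"]) simp

lemma polyfun_le_monomial:
  assumes "polyfun_le 1 X" "polyfun_le 2 Y" "i + 2 * j \<le> N"
  shows "polyfun_le N (\<lambda>h. c * X h ^ i * Y h ^ j)"
  by (rule polyfun_le_mono[OF polyfun_le_mult[OF polyfun_le_mult[OF polyfun_le_const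
          polyfun_le_power[OF assms(1)]] polyfun_le_power[OF assms(2)]]]) (use assms(3) in simp)

context
  fixes P :: "real \<times> real \<Rightarrow> real" and a :: "nat \<Rightarrow> nat \<Rightarrow> real" and n :: nat
  assumes P: "\<And>x y. P (x, y) = (\<Sum>i\<le>n. \<Sum>j\<le>n - i. a i j * x ^ i * y ^ j)"
begin

text \<open>Truncated subtraction in the exponent is harmless: at i = 0 the factor
  \<open>real i\<close> vanishes, and likewise at j = 0 in \<open>dy\<close>.\<close>

private definition "dx z = (\<Sum>i\<le>n. \<Sum>j\<le>n - i. a i j * real i * fst z ^ (i - 1) * snd z ^ j)"
private definition "dy z = (\<Sum>i\<le>n. \<Sum>j\<le>n - i. a i j * real j * fst z ^ i * snd z ^ (j - 1))"

private lemma DERIV_P: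
  assumes "(X has_real_derivative X') (at t)" "(Y has_real_derivative Y') (at t)"
  shows "((\<lambda>t. P (X t, Y t)) has_real_derivative dx (X t, Y t) * X' + dy (X t, Y t) * Y') (at t)"
  unfolding P dx_def dy_def sum_distrib_right sum.distrib[symmetric]
  by (intro DERIV_sum) (auto intro!: derivative_eq_intros assms simp: algebra_simps)

private lemma partial_x_eq: "partial_x P = dx"
proof
  fix z :: "real \<times> real"
  show "partial_x P z = dx z"
    unfolding partial_x_def using DERIV_imp_deriv[OF DERIV_P[OF DERIV_ident DERIV_const]]
    by (cases z) simp
qed

private lemma partial_y_eq: "partial_y P = dy"
proof
  fix z :: "real \<times> real"
  show "partial_y P z = dy z"
    unfolding partial_y_def using DERIV_imp_deriv[OF DERIV_P[OF DERIV_const DERIV_ident]]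
    by (cases z) simp
qed

lemma coeffs_DERIV:
  assumes "(X has_real_derivative X') (at t)" "(Y has_real_derivative Y') (at t)"
  shows "((\<lambda>t. P (X t, Y t)) has_real_derivative
     partial_x P (X t, Y t) * X' + partial_y P (X t, Y t) * Y') (at t)"
  unfolding partial_x_eq partial_y_eq by (rule DERIV_P[OF assms])

lemma coeffs_continuous:
  "continuous_on UNIV P" "continuous_on UNIV (partial_x P)" "continuous_on UNIV (partial_y P)"
proof -
  have "P = (\<lambda>z. \<Sum>i\<le>n. \<Sum>j\<le>n - i. a i j * fst z ^ i * snd z ^ j)"
    by (auto simp: P)
  then show "continuous_on UNIV P" by (auto intro!: continuous_intros)
  show "continuous_on UNIV (partial_x P)" "continuous_on UNIV (partial_y P)"
    unfolding partial_x_eq partial_y_eq dx_def dy_def by (auto intro!: continuous_intros)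
qed

text \<open>A monomial with exponents i and j has degree at most i + 2j along the curve, and i + j
  \<le> n gives 2n; differentiation only lowers exponents.\<close>

lemma coeffs_polyfun:
  assumes XY: "polyfun_le 1 X" "polyfun_le 2 Y"
  shows "polyfun_le (2 * n) (\<lambda>h. P (X h, Y h))"
    and "polyfun_le (2 * n) (\<lambda>h. partial_x P (X h, Y h))"
    and "polyfun_le (2 * n) (\<lambda>h. partial_y P (X h, Y h))"
  unfolding partial_x_eq partial_y_eq dx_def dy_def P fst_conv snd_conv
  by (intro polyfun_le_sum polyfun_le_monomial XY; auto)+

end

lemma poly2_DERIV:
  assumes "P \<in> poly2 n" "(X has_real_derivative X') (at t)" "(Y has_real_derivative Y') (at t)"
  shows "((\<lambda>t. P (X t, Y t)) has_real_derivative
     partial_x P (X t, Y t) * X' + partial_y P (X t, Y t) * Y') (at t)"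
  using assms(1) coeffs_DERIV[OF _ assms(2,3)] unfolding poly2_def by blast

lemma poly2_continuous:
  assumes "P \<in> poly2 n"
  shows "continuous_on UNIV P" "continuous_on UNIV (partial_x P)" "continuous_on UNIV (partial_y P)"
  using assms coeffs_continuous unfolding poly2_def by blast+

lemma poly2_polyfun:
  assumes "P \<in> poly2 n" "polyfun_le 1 X" "polyfun_le 2 Y"
  shows "polyfun_le (2 * n) (\<lambda>h. P (X h, Y h))"
    and "polyfun_le (2 * n) (\<lambda>h. partial_x P (X h, Y h))"
    and "polyfun_le (2 * n) (\<lambda>h. partial_y P (X h, Y h))"
  using assms(1) coeffs_polyfun[OF _ assms(2,3)] unfolding poly2_def by blast+

section \<open>Markov and Schur inequalities on the triangle\<close>

text \<open>The norm inequality raised to the power p, which avoids roots and a case distinction on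
  finiteness. Writing the constant as \<open>c powr p\<close> makes constants multiply under
  composition.\<close>

definition Lp_le :: "'a measure \<Rightarrow> real \<Rightarrow> real \<Rightarrow> ('a \<Rightarrow> real) \<Rightarrow> ('a \<Rightarrow> real) \<Rightarrow> bool" where
  "Lp_le M p c f g \<longleftrightarrow>
    (\<integral>\<^sup>+z. ennreal (\<bar>f z\<bar> powr p) \<partial>M) \<le> ennreal (c powr p) * (\<integral>\<^sup>+z. ennreal (\<bar>g z\<bar> powr p) \<partial>M)"

lemma Lp_le_trans:
  assumes "Lp_le M p b f g" "Lp_le M p c g k"
  shows "Lp_le M p (b * c) f k"
proof -
  have "(\<integral>\<^sup>+z. ennreal (\<bar>f z\<bar> powr p) \<partial>M)
    \<le> ennreal (b powr p) * (ennreal (c powr p) * (\<integral>\<^sup>+z. ennreal (\<bar>k z\<bar> powr p) \<partial>M))"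
    using assms unfolding Lp_le_def by (meson mult_left_mono order_trans zero_le)
  then show ?thesis
    by (simp add: Lp_le_def powr_mult ennreal_mult' mult.assoc)
qed

lemma Lp_le_mono:
  assumes "Lp_le M p b f g" "0 \<le> b" "b \<le> c" "0 \<le> p"
  shows "Lp_le M p c f g"
  using assms(1) unfolding Lp_le_def
  by (rule order_trans) (use assms in \<open>intro mult_right_mono ennreal_leI powr_mono2; simp\<close>)

lemma Lp_le_sum:
  fixes c :: "'a \<Rightarrow> real" and g :: "'a \<Rightarrow> 'b \<Rightarrow> real"
  assumes "p \<ge> 1" "finite S"
    and "\<And>z. z \<in> space M \<Longrightarrow> f z = (\<Sum>k\<in>S. c k * g k z)"
    and "\<And>k. k \<in> S \<Longrightarrow> g k \<in> borel_measurable M"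
    and "\<And>k. k \<in> S \<Longrightarrow> Lp_le M p B (g k) G"
    and "(\<Sum>k\<in>S. \<bar>c k\<bar>) \<le> A"
  shows "Lp_le M p (A * B) f G"
  unfolding Lp_le_def powr_mult
  using nn_integral_powr_sum_le[OF assms(1-4) _ assms(6), of "ennreal (B powr p) * (\<integral>\<^sup>+z. ennreal (\<bar>G z\<bar> powr p) \<partial>M)"]
    assms(5) by (simp add: Lp_le_def ennreal_mult' mult.assoc)

lemma Lp_le_add:
  assumes "p \<ge> 1" "\<And>z. z \<in> space M \<Longrightarrow> f z = a * g z + b * k z"
    and "g \<in> borel_measurable M" "k \<in> borel_measurable M"
    and "Lp_le M p B g G" "Lp_le M p B k G"
  shows "Lp_le M p ((\<bar>a\<bar> + \<bar>b\<bar>) * B) f G"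
  using Lp_le_sum[of p "UNIV :: bool set" M f "\<lambda>i. if i then a else b" "\<lambda>i. if i then g else k" B G]
    assms by (simp add: UNIV_bool add.commute)

lemma tri_Lp_le_pointwise:
  assumes p: "p \<ge> 1" and [measurable]: "f \<in> borel_measurable borel" "g \<in> borel_measurable borel"
    and c: "c \<ge> 0" and le: "\<And>z. z \<in> tri \<Longrightarrow> \<bar>f z\<bar> \<le> c * \<bar>g z\<bar>"
  shows "Lp_le tri_measure p c f g"
proof -
  have "(\<integral>\<^sup>+z. ennreal (\<bar>f z\<bar> powr p) \<partial>tri_measure)
    \<le> (\<integral>\<^sup>+z. ennreal (c powr p) * ennreal (\<bar>g z\<bar> powr p) \<partial>tri_measure)"
  proof (rule nn_integral_tri_measure_mono)
    fix z assume "z \<in> tri"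
    from le[OF this] have "\<bar>f z\<bar> powr p \<le> (c * \<bar>g z\<bar>) powr p"
      using p by (intro powr_mono2) auto
    then show "ennreal (\<bar>f z\<bar> powr p) \<le> ennreal (c powr p) * ennreal (\<bar>g z\<bar> powr p)"
      by (simp add: powr_mult ennreal_leI flip: ennreal_mult')
  qed measurable
  also have "\<dots> = ennreal (c powr p) * (\<integral>\<^sup>+z. ennreal (\<bar>g z\<bar> powr p) \<partial>tri_measure)"
    by (rule nn_integral_cmult) measurable
  finally show ?thesis unfolding Lp_le_def .
qed

text \<open>The integral bound 8 corresponds to the norm bound 8 powr (1 / p); relaxing it to 8
  keeps the constants independent of p.\<close>

lemma tri_Lp_le_contraction:
  assumes p: "p \<ge> 1" and [measurable]: "f \<in> borel_measurable borel" and h: "0 \<le> h" "h \<le> 1 / 2"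
    and ab: "0 \<le> b" "\<bar>a\<bar> + b \<le> 1"
  shows "Lp_le tri_measure p 8 (\<lambda>z. f (h *\<^sub>R (a, b) + (1 - h) *\<^sub>R z)) f"
proof -
  have "8 powr 1 \<le> 8 powr p" using p by (intro powr_mono) auto
  then have "8 \<le> ennreal (8 powr p)"
    by (metis ennreal_leI ennreal_numeral powr_one zero_le_numeral)
  then have "8 * (\<integral>\<^sup>+z. ennreal (\<bar>f z\<bar> powr p) \<partial>tri_measure)
    \<le> ennreal (8 powr p) * (\<integral>\<^sup>+z. ennreal (\<bar>f z\<bar> powr p) \<partial>tri_measure)"
    by (rule mult_right_mono) simp
  moreover have "(\<integral>\<^sup>+z. ennreal (\<bar>f (h *\<^sub>R (a, b) + (1 - h) *\<^sub>R z)\<bar> powr p) \<partial>tri_measure)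
    \<le> 8 * (\<integral>\<^sup>+z. ennreal (\<bar>f z\<bar> powr p) \<partial>tri_measure)"
    by (rule nn_integral_tri_contraction[OF _ h ab]) measurable
  ultimately show ?thesis unfolding Lp_le_def by (rule order_trans[rotated])
qed

text \<open>For a polynomial \<^term>\<open>f\<close> the curve of functions obtained by composing with the contractions
  of the triangle towards a vertex is polynomial in the contraction parameter, and these
  contractions are uniformly bounded in $L^p$. Hence one-dimensional inequalities that are given by
  functionals with finitely many nodes transfer to $L^p$.\<close>

lemma tri_markov:
  assumes p: "p \<ge> 1" and N: "N \<ge> 1" and f [measurable]: "f \<in> borel_measurable borel"
    and ab: "0 \<le> b" "\<bar>a\<bar> + b \<le> 1"
    and pol: "\<And>z. polyfun_le N (\<lambda>h. f (h *\<^sub>R (a, b) + (1 - h) *\<^sub>R z))"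
    and D: "\<And>z. ((\<lambda>h. f (h *\<^sub>R (a, b) + (1 - h) *\<^sub>R z)) has_real_derivative D z) (at 0)"
  shows "Lp_le tri_measure p (32 * real N ^ 2) D f"
proof -
  obtain h c :: "nat \<Rightarrow> real" where
    h: "\<And>k. k \<le> N \<Longrightarrow> 0 \<le> h k \<and> h k \<le> 1 / 2" and
    c: "(\<Sum>k\<le>N. \<bar>c k\<bar>) \<le> 4 * real N ^ 2"
    "\<And>q. degree q \<le> N \<Longrightarrow> poly (pderiv q) 0 = (\<Sum>k\<le>N. c k * poly q (h k))"
    using markov_functional[OF N] by blast
  have "Lp_le tri_measure p (4 * real N ^ 2 * 8) D f"
  proof (rule Lp_le_sum[OF p finite_atMost _ _ _ c(1)])
    fix z
    obtain q where q: "degree q \<le> N" "\<And>h. f (h *\<^sub>R (a, b) + (1 - h) *\<^sub>R z) = poly q h"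
      using pol[of z] unfolding polyfun_le_def by blast
    have "D z = poly (pderiv q) 0"
      using D[of z] unfolding q(2) by (rule DERIV_unique) (rule poly_DERIV)
    then show "D z = (\<Sum>k\<le>N. c k * f (h k *\<^sub>R (a, b) + (1 - h k) *\<^sub>R z))"
      using c(2)[OF q(1)] unfolding q(2) by simp
  next
    fix k assume "k \<in> {..N}"
    then show "Lp_le tri_measure p 8 (\<lambda>z. f (h k *\<^sub>R (a, b) + (1 - h k) *\<^sub>R z)) f"
      using h by (intro tri_Lp_le_contraction[OF p f _ _ ab]) auto
  qed measurable
  then show ?thesis by (simp add: mult.commute)
qed

text \<open>Contracting towards the vertex \<^term>\<open>(0, 1)\<close> moves every point to height at least
  \<^term>\<open>h\<close>, where dividing by the height costs at most a factor \<^term>\<open>1 / h\<close>.\<close>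

lemma tri_schur:
  assumes p: "p \<ge> 1" and N: "N \<ge> 1" and f [measurable]: "f \<in> borel_measurable borel"
    and pol: "\<And>z. polyfun_le N (\<lambda>h. f (h *\<^sub>R (0, 1) + (1 - h) *\<^sub>R z))"
  shows "Lp_le tri_measure p (384 * real N ^ 2) f (\<lambda>z. snd z * f z)"
proof -
  obtain h c :: "nat \<Rightarrow> real" where
    h: "\<And>k. k \<le> N \<Longrightarrow> 1 / (24 * real N ^ 2) \<le> h k \<and> h k \<le> 1 / 2" and
    c: "(\<Sum>k\<le>N. \<bar>c k\<bar>) \<le> 2"
    "\<And>q. degree q \<le> N \<Longrightarrow> poly q 0 = (\<Sum>k\<le>N. c k * poly q (h k))"
    using extrapolation_functional[OF N] by blast
  have [measurable]: "(snd :: real \<times> real \<Rightarrow> real) \<in> borel_measurable borel"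
    by (intro borel_measurable_continuous_onI continuous_intros)
  \<comment> \<open>The three factors are the norm of the extrapolation functional, the reciprocal
    of the least height after contraction, and the contraction bound.\<close>
  have "Lp_le tri_measure p (2 * (24 * real N ^ 2 * 8)) f (\<lambda>z. snd z * f z)"
  proof (rule Lp_le_sum[OF p finite_atMost _ _ _ c(1)])
    fix z
    obtain q where q: "degree q \<le> N" "\<And>h. f (h *\<^sub>R (0, 1) + (1 - h) *\<^sub>R z) = poly q h"
      using pol[of z] unfolding polyfun_le_def by blast
    have "f z = poly q 0" using q(2)[of 0] by (simp flip: zero_prod_def)
    then show "f z = (\<Sum>k\<le>N. c k * f (h k *\<^sub>R (0, 1) + (1 - h k) *\<^sub>R z))"
      using c(2)[OF q(1)] unfolding q(2) by simp
  next
    fix k assume "k \<in> {..N}"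
    then have hk: "1 / (24 * real N ^ 2) \<le> h k" "h k \<le> 1 / 2" using h by auto
    have pos: "1 / (24 * real N ^ 2) > 0" using N by simp
    have hk0: "0 \<le> h k" using hk(1) pos by linarith
    let ?A = "\<lambda>z. h k *\<^sub>R (0, 1) + (1 - h k) *\<^sub>R z"
    \<comment> \<open>The contraction bound is applied to the product of height and
      \<open>f\<close>, so that the height is evaluated at the contracted point, where it is bounded
      below.\<close>
    show "Lp_le tri_measure p (24 * real N ^ 2 * 8) (\<lambda>z. f (?A z)) (\<lambda>z. snd z * f z)"
    proof (rule Lp_le_trans)
      show "Lp_le tri_measure p 8 (\<lambda>z. snd (?A z) * f (?A z)) (\<lambda>z. snd z * f z)"
        by (rule tri_Lp_le_contraction[OF p, where f = "\<lambda>z. snd z * f z"])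
          (use hk hk0 in auto)
      show "Lp_le tri_measure p (24 * real N ^ 2) (\<lambda>z. f (?A z)) (\<lambda>z. snd (?A z) * f (?A z))"
      proof (rule tri_Lp_le_pointwise[OF p])
        fix z assume "z \<in> tri"
        then have "(1 - h k) * snd z \<ge> 0" using hk by (auto simp: tri_def)
        then have "1 / (24 * real N ^ 2) \<le> snd (?A z)" using hk by simp
        then have "1 / (24 * real N ^ 2) \<le> \<bar>snd (?A z)\<bar>" by linarith
        then have "1 \<le> 24 * real N ^ 2 * \<bar>snd (?A z)\<bar>"
          using N by (simp add: divide_simps mult_ac)
        then show "\<bar>f (?A z)\<bar> \<le> 24 * real N ^ 2 * \<bar>snd (?A z) * f (?A z)\<bar>"
          using mult_right_mono[of 1 "24 * real N ^ 2 * \<bar>snd (?A z)\<bar>" "\<bar>f (?A z)\<bar>"]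
          by (simp only: abs_mult mult.assoc mult_1 abs_ge_zero)
      qed (use N in auto)
    qed
  qed measurable
  then show ?thesis by (simp add: mult.commute)
qed

lemma poly2_param_line:
  assumes "P \<in> poly2 n"
  shows "polyfun_le (2 * n) (\<lambda>h. P (param (h *\<^sub>R (a, b) + (1 - h) *\<^sub>R z)))"
    and "polyfun_le (2 * n) (\<lambda>h. partial_y P (param (h *\<^sub>R (a, b) + (1 - h) *\<^sub>R z)))"
proof -
  obtain m d where z: "z = (m, d)" by (cases z)
  have X: "polyfun_le 1 (\<lambda>h. 2 * (h * a + (1 - h) * m))"
    unfolding polyfun_le_def
    by (rule exI[of _ "[:2 * m, 2 * (a - m):]"]) (simp add: algebra_simps)
  have Y: "polyfun_le 2 (\<lambda>h. (h * a + (1 - h) * m)\<^sup>2 - (h * b + (1 - h) * d)\<^sup>2)"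
    unfolding polyfun_le_def
    by (rule exI[of _ "[:m\<^sup>2 - d\<^sup>2, 2 * m * (a - m) - 2 * d * (b - d), (a - m)\<^sup>2 - (b - d)\<^sup>2:]"])
      (simp add: algebra_simps power2_eq_square)
  show "polyfun_le (2 * n) (\<lambda>h. P (param (h *\<^sub>R (a, b) + (1 - h) *\<^sub>R z)))"
    "polyfun_le (2 * n) (\<lambda>h. partial_y P (param (h *\<^sub>R (a, b) + (1 - h) *\<^sub>R z)))"
    using poly2_polyfun[OF assms X Y] by (simp_all add: param_def z)
qed

text \<open>At h = 0 the segment leaves z with velocity (a, b) - z, so this is the derivative of P o
  param in that direction.\<close>

lemma poly2_param_DERIV:
  assumes "P \<in> poly2 n"
  shows "((\<lambda>h. P (param (h *\<^sub>R (a, b) + (1 - h) *\<^sub>R z))) has_real_derivative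
      partial_x P (param z) * (2 * (a - fst z)) +
      partial_y P (param z) * (2 * fst z * (a - fst z) - 2 * snd z * (b - snd z))) (at 0)"
proof -
  obtain m d where z: "z = (m, d)" by (cases z)
  have X: "((\<lambda>h. 2 * (h * a + (1 - h) * m)) has_real_derivative 2 * (a - m)) (at 0)"
    by (auto intro!: derivative_eq_intros)
  have Y: "((\<lambda>h. (h * a + (1 - h) * m)\<^sup>2 - (h * b + (1 - h) * d)\<^sup>2) has_real_derivative
      2 * m * (a - m) - 2 * d * (b - d)) (at 0)"
    by (auto intro!: derivative_eq_intros)
  show ?thesis using poly2_DERIV[OF assms X Y] by (simp add: param_def z)
qed

text \<open>Let G = P o param. The velocities towards the three vertices combine with constant
  coefficients to the coordinate directions. Half the difference for (1, 0) and (-1, 0) gives the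
  m-derivative 2 P_x + 2m P_y. Half their sum, minus the one for (0, 1), gives minus the
  d-derivative, which is 2d P_y. After the height is divided out, P_y is known, and P_x follows
  because |m| < 1.\<close>

lemma tri_partial_bounds:
  assumes p: "p \<ge> 1" and P: "P \<in> poly2 n" and n: "n \<ge> 1"
  shows "Lp_le tri_measure p (393216 * real n ^ 4) (\<lambda>z. partial_x P (param z)) (\<lambda>z. P (param z))"
    and "Lp_le tri_measure p (393216 * real n ^ 4) (\<lambda>z. partial_y P (param z)) (\<lambda>z. P (param z))"
proof -
  define N where "N = 2 * n"
  have N: "N \<ge> 1" using n by (simp add: N_def)
  have [measurable]: "P \<in> borel_measurable borel" "partial_x P \<in> borel_measurable borel"
    "partial_y P \<in> borel_measurable borel"
    using poly2_continuous[OF P] by (simp_all add: borel_measurable_continuous_onI)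
  have [measurable]: "(fst :: real \<times> real \<Rightarrow> real) \<in> borel_measurable borel"
    "(snd :: real \<times> real \<Rightarrow> real) \<in> borel_measurable borel"
    by (intro borel_measurable_continuous_onI continuous_intros)+
  define G where "G z = P (param z)" for z
  define D where "D a b z = partial_x P (param z) * (2 * (a - fst z)) +
      partial_y P (param z) * (2 * fst z * (a - fst z) - 2 * snd z * (b - snd z))" for a b z
  have Dm [measurable]: "D a b \<in> borel_measurable borel" for a b
    unfolding D_def[abs_def] by measurable
  have Gm: "G \<in> borel_measurable borel" unfolding G_def[abs_def] by measurable
  have DG: "Lp_le tri_measure p (32 * real N ^ 2) (D a b) G" if "0 \<le> b" "\<bar>a\<bar> + b \<le> 1" for a b
    by (rule tri_markov[OF p N Gm that])
      (use poly2_param_line[OF P] poly2_param_DERIV[OF P] in \<open>simp_all add: G_def N_def D_def\<close>)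
  note D1 = DG[of 0 1, simplified] and D2 = DG[of 0 "-1", simplified] and D3 = DG[of 1 0, simplified]
  define E where "E z = (1/2) * D 1 0 z + (1/2) * D (-1) 0 z" for z
  have Em [measurable]: "E \<in> borel_measurable borel" unfolding E_def[abs_def] by measurable
  have E: "Lp_le tri_measure p ((\<bar>1/2\<bar> + \<bar>1/2\<bar>) * (32 * real N ^ 2)) E G"
    by (rule Lp_le_add[OF p _ _ _ D1 D2]) (auto simp: E_def)
  have "Lp_le tri_measure p ((\<bar>1/2\<bar> + \<bar>-1/2\<bar>) * (32 * real N ^ 2))
      (\<lambda>z. snd z * partial_y P (param z)) G"
  proof (rule Lp_le_add[OF p])
    show "Lp_le tri_measure p (32 * real N ^ 2) E G" using E by simp
    show "Lp_le tri_measure p (32 * real N ^ 2) (D 0 1) G" by (rule D3)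
    show "snd z * partial_y P (param z) = 1 / 2 * E z + - 1 / 2 * D 0 1 z" for z
      by (simp add: E_def D_def field_simps)
  qed auto
  then have dPy: "Lp_le tri_measure p (32 * real N ^ 2) (\<lambda>z. snd z * partial_y P (param z)) G"
    by simp
  have Py: "Lp_le tri_measure p (384 * real N ^ 2 * (32 * real N ^ 2))
      (\<lambda>z. partial_y P (param z)) G"
    by (rule Lp_le_trans[OF tri_schur[OF p N] dPy])
      (use poly2_param_line(2)[OF P, where a = 0 and b = 1] in \<open>simp_all add: N_def\<close>)
  have mPy: "Lp_le tri_measure p (1 * (384 * real N ^ 2 * (32 * real N ^ 2)))
      (\<lambda>z. fst z * partial_y P (param z)) G"
    by (rule Lp_le_trans[OF tri_Lp_le_pointwise[OF p] Py])
      (auto simp: tri_def abs_mult intro!: mult_left_le_one_le)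
  \<comment> \<open>\<open>Lp_le_add\<close> takes one constant for both summands, so the better
    bound on \<open>F\<close> is relaxed to the order N^4 available for P_y.\<close>
  have "real N ^ 2 \<ge> 1" using N by simp
  then have N4: "32 * real N ^ 2 \<le> 384 * real N ^ 2 * (32 * real N ^ 2)"
    using mult_right_mono[of 1 "384 * real N ^ 2" "32 * real N ^ 2"] by simp
  define F where "F z = (1/2) * D 1 0 z + (-1/2) * D (-1) 0 z" for z
  have Fm [measurable]: "F \<in> borel_measurable borel" unfolding F_def[abs_def] by measurable
  have F: "Lp_le tri_measure p ((\<bar>1/2\<bar> + \<bar>-1/2\<bar>) * (32 * real N ^ 2)) F G"
    by (rule Lp_le_add[OF p _ _ _ D1 D2]) (auto simp: F_def)
  then have F': "Lp_le tri_measure p (384 * real N ^ 2 * (32 * real N ^ 2)) F G"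
    by (intro Lp_le_mono[OF _ _ N4]) (use p in auto)
  have Px: "Lp_le tri_measure p ((\<bar>1/2\<bar> + \<bar>-1\<bar>) * (384 * real N ^ 2 * (32 * real N ^ 2)))
      (\<lambda>z. partial_x P (param z)) G"
    by (rule Lp_le_add[OF p _ _ _ F' mPy[unfolded mult_1]])
      (auto simp: F_def D_def field_simps)
  \<comment> \<open>For P_y the constant is 384 * 32 * 16 = 196608; for P_x it is 3/2 of that. The
    common constant 393216 is twice it.\<close>
  have n4: "real N ^ 2 * real N ^ 2 = 16 * real n ^ 4"
    by (simp add: N_def power2_eq_square power4_eq_xxxx)
  show "Lp_le tri_measure p (393216 * real n ^ 4) (\<lambda>z. partial_x P (param z)) (\<lambda>z. P (param z))"
    using Lp_le_mono[OF Px, of "393216 * real n ^ 4"] n4 p by (simp add: G_def[abs_def])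
  show "Lp_le tri_measure p (393216 * real n ^ 4) (\<lambda>z. partial_y P (param z)) (\<lambda>z. P (param z))"
    using Lp_le_mono[OF Py, of "393216 * real n ^ 4"] n4 p by (simp add: G_def[abs_def])
qed

section \<open>Norms on the bounded domain\<close>

text \<open>Taking p-th roots; if g has infinite norm, c > 0 keeps the right side infinite.\<close>

lemma Lp_norm_le:
  assumes p: "p \<ge> 1" and c: "c > 0"
    and le: "(\<integral>\<^sup>+z\<in>S. ennreal (\<bar>f z\<bar> powr p) \<partial>lborel)
      \<le> ennreal (c powr p) * (\<integral>\<^sup>+z\<in>S. ennreal (\<bar>g z\<bar> powr p) \<partial>lborel)"
  shows "Lp_norm p S f \<le> ennreal c * Lp_norm p S g"
proof (cases "(\<integral>\<^sup>+z\<in>S. ennreal (\<bar>g z\<bar> powr p) \<partial>lborel)")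
  case top
  then have "Lp_norm p S g = \<infinity>" by (simp add: Lp_norm_def)
  then show ?thesis using c by (simp add: ennreal_mult_top)
next
  case (real J)
  have "(\<integral>\<^sup>+z\<in>S. ennreal (\<bar>f z\<bar> powr p) \<partial>lborel) \<le> ennreal (c powr p * J)"
    using le real by (simp add: ennreal_mult')
  then obtain I where I: "(\<integral>\<^sup>+z\<in>S. ennreal (\<bar>f z\<bar> powr p) \<partial>lborel) = ennreal I"
      "0 \<le> I" "I \<le> c powr p * J"
    using real by (cases "(\<integral>\<^sup>+z\<in>S. ennreal (\<bar>f z\<bar> powr p) \<partial>lborel)") (auto simp: top_unique)
  have "I powr (1 / p) \<le> (c powr p * J) powr (1 / p)"
    using I p by (intro powr_mono2) auto
  also have "\<dots> = c * J powr (1 / p)"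
    using p c by (simp add: powr_mult powr_powr)
  finally show ?thesis
    using real I c by (simp add: Lp_norm_def ennreal_leI flip: ennreal_mult')
qed

lemma Lp_norm_0: "Lp_norm p S (\<lambda>_. 0) = 0"
  by (simp add: Lp_norm_def)

lemma Omega_bdd_Lp_norm_le:
  assumes p: "p \<ge> 1" and c: "c > 0"
    and [measurable]: "f \<in> borel_measurable borel" "g \<in> borel_measurable borel"
    and le: "Lp_le tri_measure p c (\<lambda>z. f (param z)) (\<lambda>z. g (param z))"
  shows "Lp_norm p Omega_bdd f \<le> ennreal c * Lp_norm p Omega_bdd g"
proof (rule Lp_norm_le[OF p c])
  show "(\<integral>\<^sup>+z\<in>Omega_bdd. ennreal (\<bar>f z\<bar> powr p) \<partial>lborel)
      \<le> ennreal (c powr p) * (\<integral>\<^sup>+z\<in>Omega_bdd. ennreal (\<bar>g z\<bar> powr p) \<partial>lborel)"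
    using mult_left_mono[OF le[unfolded Lp_le_def], of 4]
    by (subst (1 2) nn_integral_Omega_bdd) (simp_all add: mult.left_commute)
qed

text \<open>For n = 0 the factor n^4 makes the right side 0, even for an infinite norm, so the
  derivatives must vanish identically.\<close>

lemma poly2_0_partials:
  assumes "P \<in> poly2 0"
  shows "partial_x P = (\<lambda>_. 0)" "partial_y P = (\<lambda>_. 0)"
proof -
  obtain c where "P (x, y) = c" for x y
    using assms unfolding poly2_def by auto
  then show "partial_x P = (\<lambda>_. 0)" "partial_y P = (\<lambda>_. 0)"
    by (auto simp: partial_x_def partial_y_def)
qed

lemma markov_Omega_bdd:
  assumes p: "p \<ge> 1" and P: "P \<in> poly2 n"
  shows "max (Lp_norm p Omega_bdd (partial_x P)) (Lp_norm p Omega_bdd (partial_y P))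
    \<le> ennreal (393216 * real n ^ 4) * Lp_norm p Omega_bdd P"
proof (cases "n = 0")
  case True
  then show ?thesis using poly2_0_partials P by (simp add: Lp_norm_0)
next
  case False
  then show ?thesis
    using tri_partial_bounds[OF p P] poly2_continuous[OF P] p
    by (intro max.boundedI Omega_bdd_Lp_norm_le) (simp_all add: borel_measurable_continuous_onI)
qed

section \<open>Infinite norms on the unbounded set\<close>

text \<open>An open cone with apex (3, 2), bounded by the tangents to the parabola at (2, 1) and (4,
  4). In the coordinates u, v it is 1 < v < 2 < u, up to order. A cone is chosen because dilations
  about its apex preserve it.\<close>

definition wedge :: "(real \<times> real) set" where
  "wedge = {(x, y). x - 1 < y \<and> y < 2 * x - 4}"

lemma open_wedge: "open wedge"
  unfolding wedge_def case_prod_beta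
  by (intro open_Collect_conj open_Collect_less continuous_intros)

lemma wedge_borel [measurable]: "wedge \<in> sets borel"
  using open_wedge by simp

lemma wedge_subset_Omega: "wedge \<subseteq> Omega"
proof
  fix z assume "z \<in> wedge"
  then obtain x y where z: "z = (x, y)" "x - 1 < y" "y < 2 * x - 4" by (auto simp: wedge_def)
  \<comment> \<open>The line y = 2x - 4 is tangent at x = 4, so this square is its gap below the
    parabola, multiplied by 4.\<close>
  have "0 \<le> (x - 4)\<^sup>2" by simp
  also have "\<dots> = x\<^sup>2 - 4 * (2 * x - 4)" by (simp add: power2_eq_square algebra_simps)
  finally have "4 * y < x\<^sup>2" using z(3) by argo
  then show "z \<in> Omega" using z by (auto simp: Omega_def)
qed

lemma nn_integral_wedge_dilation:
  assumes [measurable]: "g \<in> borel_measurable borel" and t: "t > 0"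
  shows "(\<integral>\<^sup>+z\<in>wedge. g z \<partial>lborel)
    = ennreal (t ^ 2) * (\<integral>\<^sup>+z\<in>wedge. g ((1 - t) *\<^sub>R (3, 2) + t *\<^sub>R z) \<partial>lborel)"
proof -
  have "(1 - t) *\<^sub>R (3, 2) + t *\<^sub>R z \<in> wedge \<longleftrightarrow> z \<in> wedge" for z
  proof -
    obtain x y where z: "z = (x, y)" by (cases z)
    have 1: "((1 - t) * 3 + t * x - 1 < (1 - t) * 2 + t * y) \<longleftrightarrow> 0 < t * (y - (x - 1))"
      by (simp add: algebra_simps)
    have 2: "((1 - t) * 2 + t * y < 2 * ((1 - t) * 3 + t * x) - 4) \<longleftrightarrow> 0 < t * (2 * x - 4 - y)"
      by (simp add: algebra_simps)
    show ?thesis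
      using t unfolding z wedge_def by (simp add: 1[simplified] 2[simplified] zero_less_mult_iff)
  qed
  then have "indicator wedge ((1 - t) *\<^sub>R (3, 2) + t *\<^sub>R z) = (indicator wedge z :: ennreal)" for z
    by (simp only: indicator_def)
  then show ?thesis
    using nn_integral_lborel_affine[of "\<lambda>z. g z * indicator wedge z" t "(1 - t) *\<^sub>R (3, 2)"] t
    by (simp add: power2_eq_square)
qed

text \<open>Extrapolation expresses \<^term>\<open>P\<close> on the wedge by far dilates of \<^term>\<open>P\<close> about the apex, whose
  norms carry a small Jacobian factor; so a finite norm is bounded by half of itself.\<close>

lemma poly2_wedge_integral:
  assumes p: "p \<ge> 1" and P: "P \<in> poly2 n" and n: "n \<ge> 1"
    and fin: "(\<integral>\<^sup>+z\<in>wedge. ennreal (\<bar>P z\<bar> powr p) \<partial>lborel) < \<infinity>"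
  shows "(\<integral>\<^sup>+z\<in>wedge. ennreal (\<bar>P z\<bar> powr p) \<partial>lborel) = 0"
proof -
  define N where "N = 2 * n"
  have N: "N \<ge> 1" using n by (simp add: N_def)
  have [measurable]: "P \<in> borel_measurable borel"
    using poly2_continuous[OF P] by (simp add: borel_measurable_continuous_onI)
  define M where "M = density lborel (indicator wedge :: _ \<Rightarrow> ennreal)"
  have [simp, measurable_cong]: "sets M = sets borel" "space M = UNIV" by (simp_all add: M_def)
  have M: "(\<integral>\<^sup>+z. g z \<partial>M) = (\<integral>\<^sup>+z\<in>wedge. g z \<partial>lborel)"
    if "g \<in> borel_measurable borel" for g :: "real \<times> real \<Rightarrow> ennreal"
    unfolding M_def using that by (subst nn_integral_density) (simp_all add: mult.commute)
  define I where "I = (\<integral>\<^sup>+z. ennreal (\<bar>P z\<bar> powr p) \<partial>M)"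
  have I: "I = (\<integral>\<^sup>+z\<in>wedge. ennreal (\<bar>P z\<bar> powr p) \<partial>lborel)"
    unfolding I_def by (rule M) measurable
  obtain h c :: "nat \<Rightarrow> real" where
    h: "\<And>k. k \<le> N \<Longrightarrow> 1 / (24 * real N ^ 2) \<le> h k \<and> h k \<le> 1 / 2" and
    c: "(\<Sum>k\<le>N. \<bar>c k\<bar>) \<le> 2"
    "\<And>q. degree q \<le> N \<Longrightarrow> poly q 0 = (\<Sum>k\<le>N. c k * poly q (h k))"
    using extrapolation_functional[OF N] by blast
  \<comment> \<open>The scale makes every dilation factor 1 + s h_k at least 2 powr p. The Jacobian
    then saves (2 powr p)^2 against the loss 2 powr p from the functional, leaving a factor at most
    1/2.\<close>
  define s where "s = 24 * real N ^ 2 * 2 powr p"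
  let ?A = "\<lambda>h z. (1 - (1 + s * h)) *\<^sub>R (3, 2) + (1 + s * h) *\<^sub>R z"
  have "I \<le> ennreal (2 powr p) * (ennreal (1 / (2 powr p) ^ 2) * I)"
    unfolding I_def
  proof (rule nn_integral_powr_sum_le[OF p finite_atMost _ _ _ c(1)])
    fix z :: "real \<times> real"
    obtain x y where z: "z = (x, y)" by (cases z)
    have X: "polyfun_le 1 (\<lambda>h. (1 - (1 + s * h)) * 3 + (1 + s * h) * x)"
      unfolding polyfun_le_def by (rule exI[of _ "[:x, s * (x - 3):]"]) (simp add: algebra_simps)
    have Y: "polyfun_le 2 (\<lambda>h. (1 - (1 + s * h)) * 2 + (1 + s * h) * y)"
      unfolding polyfun_le_def by (rule exI[of _ "[:y, s * (y - 2):]"]) (simp add: algebra_simps)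
    obtain q where q: "degree q \<le> N" "\<And>h. P (?A h z) = poly q h"
      using poly2_polyfun(1)[OF P X Y] unfolding polyfun_le_def N_def z by auto
    have "P z = poly q 0" using q(2)[of 0] by (simp flip: zero_prod_def)
    then show "P z = (\<Sum>k\<le>N. c k * P (?A (h k) z))"
      using c(2)[OF q(1)] unfolding q(2) by simp
  next
    fix k assume "k \<in> {..N}"
    then have "1 / (24 * real N ^ 2) \<le> h k" using h by auto
    then have "s * (1 / (24 * real N ^ 2)) \<le> s * h k"
      by (intro mult_left_mono) (simp_all add: s_def)
    moreover have "s * (1 / (24 * real N ^ 2)) = 2 powr p" using N by (simp add: s_def)
    ultimately have t: "2 powr p \<le> 1 + s * h k" by linarith
    have pos: "0 < 1 + s * h k" using t powr_gt_zero[of 2 p] by linarith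
    have "(2 powr p) ^ 2 \<le> (1 + s * h k) ^ 2" using t by (intro power_mono) auto
    then have "1 \<le> 1 / (2 powr p) ^ 2 * (1 + s * h k) ^ 2"
      by (simp add: divide_simps)
    then have "1 \<le> ennreal (1 / (2 powr p) ^ 2 * (1 + s * h k) ^ 2)"
      using ennreal_leI by fastforce
    then have "1 * (\<integral>\<^sup>+z. ennreal (\<bar>P (?A (h k) z)\<bar> powr p) \<partial>M)
      \<le> ennreal (1 / (2 powr p) ^ 2 * (1 + s * h k) ^ 2)
        * (\<integral>\<^sup>+z. ennreal (\<bar>P (?A (h k) z)\<bar> powr p) \<partial>M)"
      by (rule mult_right_mono) simp
    also have "\<dots> = ennreal (1 / (2 powr p) ^ 2) * (ennreal ((1 + s * h k) ^ 2)
        * (\<integral>\<^sup>+z. ennreal (\<bar>P (?A (h k) z)\<bar> powr p) \<partial>M))"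
      by (simp only: ennreal_mult' zero_le_power2 zero_le_divide_1_iff mult.assoc)
    also have "ennreal ((1 + s * h k) ^ 2) * (\<integral>\<^sup>+z. ennreal (\<bar>P (?A (h k) z)\<bar> powr p) \<partial>M)
      = (\<integral>\<^sup>+z. ennreal (\<bar>P z\<bar> powr p) \<partial>M)"
    proof -
      have "(\<lambda>z. ennreal (\<bar>P z\<bar> powr p)) \<in> borel_measurable borel"
        "(\<lambda>z. ennreal (\<bar>P (?A (h k) z)\<bar> powr p)) \<in> borel_measurable borel" by measurable
      then show ?thesis by (simp only: M nn_integral_wedge_dilation[OF _ pos])
    qed
    finally show "(\<integral>\<^sup>+z. ennreal (\<bar>P (?A (h k) z)\<bar> powr p) \<partial>M)
      \<le> ennreal (1 / (2 powr p) ^ 2) * (\<integral>\<^sup>+z. ennreal (\<bar>P z\<bar> powr p) \<partial>M)" by simp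
  qed measurable
  moreover obtain r where r: "I = ennreal r" "r \<ge> 0"
    using fin unfolding I[symmetric] by (cases I) auto
  ultimately have "ennreal r \<le> ennreal (2 powr p * (1 / (2 powr p) ^ 2 * r))"
    by (simp only: ennreal_mult' powr_ge_zero zero_le_divide_1_iff zero_le_power2)
  then have "r \<le> 2 powr p * (1 / (2 powr p) ^ 2 * r)"
    using r by (subst (asm) ennreal_le_iff) auto
  also have "\<dots> = r / 2 powr p" by (simp add: power2_eq_square)
  finally have "r * 2 powr p \<le> r" by (simp add: divide_simps)
  moreover have "2 powr 1 \<le> 2 powr p" using p by (intro powr_mono) auto
  then have "r * 2 \<le> r * 2 powr p" using r by (intro mult_left_mono) auto
  ultimately have "r = 0" using r by linarith
  then show ?thesis using I r by simp
qed

text \<open>Along the line from the wedge point (4, 7/2) at h = 0 to z at h = 1, P is a univariate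
  polynomial that vanishes on an open set of parameters, hence everywhere.\<close>

lemma poly2_eq_0:
  assumes P: "P \<in> poly2 n" and 0: "\<And>z. z \<in> wedge \<Longrightarrow> P z = 0"
  shows "P = (\<lambda>_. 0)"
proof
  fix z :: "real \<times> real"
  obtain x y where z: "z = (x, y)" by (cases z)
  let ?l = "\<lambda>h. (4 + h * (x - 4), 7/2 + h * (y - 7/2))"
  obtain q where q: "\<And>h. P (?l h) = poly q h"
    using poly2_polyfun(1)[OF P polyfun_le_affine polyfun_le_mono[OF polyfun_le_affine]]
    unfolding polyfun_le_def by (metis one_le_numeral)
  have "open {h. 4 + h * (x - 4) - 1 < 7/2 + h * (y - 7/2) \<and>
      7/2 + h * (y - 7/2) < 2 * (4 + h * (x - 4)) - 4}" (is "open ?U")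
    by (intro open_Collect_conj open_Collect_less continuous_intros)
  moreover have "0 \<in> ?U" by simp
  ultimately have "infinite ?U" using finite_imp_not_open by blast
  moreover have "?U \<subseteq> {h. poly q h = 0}"
    using 0 q[symmetric] by (auto simp: wedge_def)
  ultimately have "q = 0" using poly_roots_finite[of q] finite_subset by blast
  then show "P z = 0" using q[of 1] by (simp add: z)
qed

text \<open>A zero integral makes P vanish almost everywhere on the wedge; the set where it does not
  vanish is open and null, hence empty.\<close>

lemma poly2_wedge_finite_imp_0:
  assumes p: "p \<ge> 1" and P: "P \<in> poly2 n" and n: "n \<ge> 1"
    and fin: "(\<integral>\<^sup>+z\<in>wedge. ennreal (\<bar>P z\<bar> powr p) \<partial>lborel) < \<infinity>"
  shows "P = (\<lambda>_. 0)"
proof (rule poly2_eq_0[OF P], rule ccontr)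
  fix z assume z: "z \<in> wedge" "P z \<noteq> 0"
  have [measurable]: "P \<in> borel_measurable borel"
    using poly2_continuous[OF P] by (simp add: borel_measurable_continuous_onI)
  let ?U = "wedge \<inter> {z. P z \<noteq> 0}"
  have "AE z in lborel. ennreal (\<bar>P z\<bar> powr p) * indicator wedge z = 0"
    using poly2_wedge_integral[OF p P n fin] by (subst (asm) nn_integral_0_iff_AE) measurable
  then have "AE z in lborel. z \<notin> ?U"
    by eventually_elim (use p in \<open>auto simp: indicator_def split: if_splits\<close>)
  then have "?U \<in> null_sets lborel"
    by (subst (asm) AE_iff_null_sets[symmetric]) auto
  then have "negligible ?U"
    using negligible_iff_null_sets null_sets_completionI by blast
  moreover have "open ?U"
    using open_wedge poly2_continuous(1)[OF P] by (intro open_Int open_Collect_neq) auto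
  ultimately show False using z open_not_negligible by blast
qed

text \<open>For n \<ge> 1 and nonzero P the wedge alone makes the right side infinite; otherwise the
  derivatives vanish. Any positive constant works, and 1 is taken.\<close>

lemma markov_Omega:
  assumes p: "p \<ge> 1" and P: "P \<in> poly2 n"
  shows "max (Lp_norm p Omega (partial_x P)) (Lp_norm p Omega (partial_y P))
    \<le> ennreal (1 * real n ^ 4) * Lp_norm p Omega P"
proof -
  consider "n = 0" | "P = (\<lambda>_. 0)" | "n \<ge> 1" "P \<noteq> (\<lambda>_. 0)" by linarith
  then show ?thesis
  proof cases
    case 1
    then show ?thesis using poly2_0_partials P by (simp add: Lp_norm_0)
  next
    case 2
    then have "partial_x P = (\<lambda>_. 0)" "partial_y P = (\<lambda>_. 0)"
      by (auto simp: partial_x_def partial_y_def)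
    then show ?thesis by (simp add: Lp_norm_0)
  next
    case 3
    have "\<infinity> \<le> (\<integral>\<^sup>+z\<in>wedge. ennreal (\<bar>P z\<bar> powr p) \<partial>lborel)"
      using poly2_wedge_finite_imp_0[OF p P] 3 by (metis not_le)
    also have "\<dots> \<le> (\<integral>\<^sup>+z\<in>Omega. ennreal (\<bar>P z\<bar> powr p) \<partial>lborel)"
      using wedge_subset_Omega by (intro nn_integral_mono) (auto split: split_indicator)
    finally have "Lp_norm p Omega P = \<infinity>" by (simp add: Lp_norm_def top_unique)
    then show ?thesis using 3(1) by (simp add: ennreal_mult_top)
  qed
qed

theorem theorem3p1:
  fixes p :: real
  assumes "p \<ge> 1"
  shows "(\<exists>C::real. C > 0 \<and> (\<forall>n::nat. \<forall>P \<in> poly2 n.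
            max (Lp_norm p Omega (partial_x P)) (Lp_norm p Omega (partial_y P))
              \<le> ennreal (C * real n ^ 4) * Lp_norm p Omega P))
       \<and> (\<exists>C::real. C > 0 \<and> (\<forall>n::nat. \<forall>P \<in> poly2 n.
            max (Lp_norm p Omega_bdd (partial_x P)) (Lp_norm p Omega_bdd (partial_y P))
              \<le> ennreal (C * real n ^ 4) * Lp_norm p Omega_bdd P))"
  using markov_Omega[OF assms] markov_Omega_bdd[OF assms]
  by (intro conjI exI[of _ 1] exI[of _ 393216]) auto

end
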